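(* There exists $N_0$ such that for every integer $n\ge N_0$, the hypercube $Q_n$ has $3$ pairwise almost orthogonal symmetric chain decompositions.
   Context: $Q_n$ denotes the Boolean lattice of all subsets of $[n]=\{1,\dots,n\}$ ordered by inclusion. A symmetric chain in $Q_n$ is a chain consisting of exactly one subset of each size $j,j+1,\dots,n-j$ for some $j$; a symmetric chain decomposition of $Q_n$ is a partition of $Q_n$ into symmetric chains (exactly one of its chains contains both $\varnothing$ and $[n]$). Two symmetric chain decompositions $\mathcal{F},\mathcal{G}$ of $Q_n$ are almost orthogonal if for every chain $A\in\mathcal{F}$ and $B\in\mathcal{G}$ we have $|A\cap B|\le 1$, except when $A$ and $B$ both contain $\varnothing$ and $[n]$, in which case $|A\cap B|=2$. A family of symmetric chain decompositions is almost orthogonal if every pair of them is. *)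

theory Defs
  imports Main "HOL-Library.Disjoint_Sets"
begin

definition hypercube :: "nat \<Rightarrow> nat set set" where
  "hypercube n = Pow {1..n}"

text \<open>The bijectivity of \<^const>\<open>card\<close> onto \<open>{j..n - j}\<close> says that the chain has exactly one
  member of each size \<open>j, \<dots>, n - j\<close> and no other members. The condition \<open>2 * j \<le> n\<close>
  excludes the empty chain.\<close>

definition symmetric_chain :: "nat \<Rightarrow> nat set set \<Rightarrow> bool" where
  "symmetric_chain n C \<longleftrightarrow>
     subset.chain (hypercube n) C \<and> (\<exists>j. 2 * j \<le> n \<and> bij_betw card C {j..n - j})"

definition symmetric_chain_decomposition :: "nat \<Rightarrow> nat set set set \<Rightarrow> bool" where
  "symmetric_chain_decomposition n \<F> \<longleftrightarrow>
     partition_on (hypercube n) \<F> \<and> (\<forall>C\<in>\<F>. symmetric_chain n C)"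

definition almost_orthogonal :: "nat \<Rightarrow> nat set set set \<Rightarrow> nat set set set \<Rightarrow> bool" where
  "almost_orthogonal n \<F> \<G> \<longleftrightarrow>
     (\<forall>A\<in>\<F>. \<forall>B\<in>\<G>.
        if {{}, {1..n}} \<subseteq> A \<and> {{}, {1..n}} \<subseteq> B
        then card (A \<inter> B) = 2
        else card (A \<inter> B) \<le> 1)"

definition almost_orthogonal_family :: "nat \<Rightarrow> nat set set set set \<Rightarrow> bool" where
  "almost_orthogonal_family n S \<longleftrightarrow>
     (\<forall>\<F>\<in>S. symmetric_chain_decomposition n \<F>) \<and> pairwise (almost_orthogonal n) S"

end

theory Submission
  imports Defs "HOL-Library.Nat_Bijection"
begin

text \<open>A product of symmetric chains of \<open>Q\<^sub>p\<close> and \<open>Q\<^sub>q\<close> is a grid in \<open>Q\<^sub>p\<^sub>+\<^sub>q\<close>, which splits into symmetric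
  chains. Doing this for three pairwise almost orthogonal decompositions of each factor, the only
  obstructions to almost orthogonality are two points \<open>(\<emptyset>, B)\<close>, \<open>([p], B)\<close> in the same row, or
  \<open>(A, \<emptyset>)\<close>, \<open>(A, [q])\<close> in the same column, that lie on one chain of two of the
  products. To exclude them, colour the subsets with three colours. If every chain of the \<open>i\<close>-th
  decomposition of \<open>Q\<^sub>q\<close> contains a set of colour \<open>i\<close>, and so does every chain of size at most 2
  of the \<open>i\<close>-th decomposition of \<open>Q\<^sub>p\<close>, then the grids can be split so that in the \<open>i\<close>-th product such
  a bad pair has \<open>B\<close>, respectively \<open>A\<close>, of colour \<open>i\<close>, which can happen for one \<open>i\<close> only. The
  colouring of \<open>Q\<^sub>q\<close> moreover still meets all chains of size at most 2 in the products.
  Coloured triples exist for \<open>n = 5\<close> and \<open>n = 7\<close>, and every \<open>n \<ge> 24\<close> is a sum of fives and sevens.\<close>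

section \<open>Symmetric chains in a grid\<close>

lemma nat_cases_0_1_ge2: obtains "k = 0" | "k = 1" | "2 \<le> (k::nat)"
  by linarith

text \<open>On the grid \<open>{0..P} \<times> {0..Q}\<close>, the points of rank \<open>r\<close> are numbered \<open>0, \<dots>, level r\<close> by their first
  coordinate, and chain \<open>k\<close> passes through the point number \<open>shift k (level r)\<close>. Chain \<open>M\<close>, which lives
  only on the levels \<open>M\<close>, is inserted at position \<open>v\<close>, so that the marked column \<open>s\<close> and row \<open>t\<close> are
  met as required by \<open>idx_column\<close>, \<open>idx_row\<close> and \<open>idx_shortest\<close>.\<close>

locale grid =
  fixes P Q s t :: nat
  assumes s_le: "s \<le> P" and t_le: "t \<le> Q"
begin

definition M :: nat where "M = min P Q"

text \<open>On a nearly square grid chain \<open>M\<close> is the only one with at most two points,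
  and \<open>v\<close> puts it on row \<open>t\<close>. With \<open>M = 1\<close> and a long side,
  chain 0 runs along a whole row or column, and \<open>v\<close> makes it row \<open>t\<close> or
  column \<open>s\<close>.\<close>

definition v :: nat where
  "v = (if P \<le> Suc Q \<and> Q \<le> Suc P then M - t
        else if M = 1 then (if Q = 1 then t else 1 - s) else M)"

text \<open>With \<open>base k d = k\<close> throughout, chain 0 would contain both ends of the
  first column whenever \<open>v > 0\<close>. For \<open>M \<ge> 2\<close> the chains 0 and 1 are
  therefore swapped from level 1 on.\<close>

definition base :: "nat \<Rightarrow> nat \<Rightarrow> nat" where
  "base k d = (if 2 \<le> k \<or> M < 2 then k else if k = 1 \<or> d = 0 then 0 else 1)"

definition shift :: "nat \<Rightarrow> nat \<Rightarrow> nat" where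
  "shift k d =
     (if d < M then base k d
      else if k = M then v
      else if v \<le> base k d then Suc (base k d) else base k d)"

definition level :: "nat \<Rightarrow> nat" where
  "level r = min (min r (P + Q - r)) M"

definition col :: "nat \<Rightarrow> nat \<Rightarrow> nat" where
  "col k r = shift k (level r) + (r - Q)"

lemma v_le: "v \<le> M"
  using s_le t_le by (auto simp: v_def M_def)

lemma base_le: "k \<le> d \<Longrightarrow> d < M \<Longrightarrow> base k d \<le> d"
  by (auto simp: base_def)

lemma base_less: "k < M \<Longrightarrow> base k d < M"
  by (auto simp: base_def)

lemma base_inj: "base k d = base k' d \<Longrightarrow> k \<le> d \<Longrightarrow> k' \<le> d \<Longrightarrow> d \<le> M \<Longrightarrow> k = k'"
  by (cases k rule: nat_cases_0_1_ge2; cases k' rule: nat_cases_0_1_ge2)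
    (auto simp: base_def split: if_splits)

lemma shift_le:
  assumes "k \<le> d" "d \<le> M"
  shows "shift k d \<le> d"
  using assms v_le base_le[of k d] base_less[of k d] by (auto simp: shift_def)

lemma shift_inj:
  assumes "shift k d = shift k' d" "k \<le> d" "k' \<le> d" "d \<le> M"
  shows "k = k'"
  using assms base_inj[of k d k'] by (auto simp: shift_def split: if_splits)

lemma shift_bij: "d \<le> M \<Longrightarrow> bij_betw (\<lambda>k. shift k d) {..d} {..d}"
  unfolding bij_betw_def
  by (intro conjI endo_inj_surj inj_onI) (auto intro: shift_inj shift_le)

text \<open>Read forwards this gives the unit steps on rising levels, read backwards those on
  falling levels, where the offset \<open>r - Q\<close> grows.\<close>

lemma shift_Suc:
  assumes "k \<le> d" "d < M"
  shows "shift k (Suc d) = shift k d \<or> shift k (Suc d) = Suc (shift k d)"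
  using assms by (auto simp: shift_def base_def)

lemma level_le: "level r \<le> M"
  by (simp add: level_def)

text \<open>\<open>r - Q\<close> and \<open>min P r\<close> are the least and greatest first
  coordinates of rank \<open>r\<close>.\<close>

lemma level_add: "r \<le> P + Q \<Longrightarrow> level r + (r - Q) = min P r"
  unfolding level_def M_def by linarith

lemma col_bounds:
  assumes "k \<le> level r" "r \<le> P + Q"
  shows "col k r \<le> P" "col k r \<le> r" "r - col k r \<le> Q"
  using shift_le[OF assms(1) level_le] level_add[OF assms(2)] by (auto simp: col_def)

lemma col_inj: "col k r = col k' r \<Longrightarrow> k \<le> level r \<Longrightarrow> k' \<le> level r \<Longrightarrow> k = k'"
  using shift_inj level_le by (auto simp: col_def)

lemma col_surj:
  assumes "x \<le> P" "y \<le> Q"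
  shows "\<exists>k\<le>level (x + y). col k (x + y) = x"
proof -
  have "x - (x + y - Q) \<le> level (x + y)"
    using assms level_add[of "x + y"] by linarith
  then obtain k where "k \<le> level (x + y)" "shift k (level (x + y)) = x - (x + y - Q)"
    using shift_bij[OF level_le[of "x + y"]] by (force simp: bij_betw_def set_eq_iff image_iff)
  moreover have "x + y - Q \<le> x" using assms by auto
  ultimately show ?thesis by (auto simp: col_def)
qed

lemma col_Suc:
  assumes "k \<le> level r" "k \<le> level (Suc r)" "Suc r \<le> P + Q"
  shows "col k (Suc r) = col k r \<or> col k (Suc r) = Suc (col k r)"
proof -
  \<comment> \<open>The level rises up to rank \<open>M\<close>, is constant up to
    \<open>max P Q\<close>, then falls.\<close>
  consider "r < M" | "M \<le> r" "Suc r \<le> max P Q" | "max P Q \<le> r"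
    by (meson not_less_eq_eq not_less)
  then show ?thesis
  proof cases
    case 1
    then have "level r = r" "level (Suc r) = Suc r" "r - Q = 0" "Suc r - Q = 0"
      by (auto simp: level_def M_def)
    then show ?thesis using shift_Suc[of k r] assms 1 by (auto simp: col_def)
  next
    case 2
    then have "level r = M" "level (Suc r) = M"
      by (auto simp: level_def M_def)
    then show ?thesis by (auto simp: col_def)
  next
    case 3
    then have "level r = Suc (level (Suc r))" "level (Suc r) < M" "Suc r - Q = Suc (r - Q)"
      using assms(3) by (auto simp: level_def M_def)
    then show ?thesis using shift_Suc[of k "level (Suc r)"] assms by (auto simp: col_def)
  qed
qed

lemma le_level_between:
  "k \<le> level r \<Longrightarrow> k \<le> level r' \<Longrightarrow> r \<le> q \<Longrightarrow> q \<le> r' \<Longrightarrow> k \<le> level q"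
  by (auto simp: level_def)

lemma col_mono:
  assumes "r \<le> r'" "k \<le> level r" "k \<le> level r'" "r' \<le> P + Q"
  shows "col k r \<le> col k r' \<and> r - col k r \<le> r' - col k r'"
  using assms
proof (induction r' rule: dec_induct)
  case base
  then show ?case by simp
next
  case (step q)
  have "k \<le> level q" by (rule le_level_between[of k r "Suc q"]) (use step in auto)
  then show ?case using step col_Suc[of k q] col_bounds(2)[of k q] by auto
qed

section \<open>The chain through a grid point\<close>

definition idx :: "nat \<Rightarrow> nat \<Rightarrow> nat" where
  "idx x y = (THE k. k \<le> level (x + y) \<and> col k (x + y) = x)"

lemma idx:
  assumes "x \<le> P" "y \<le> Q"
  shows "idx x y \<le> level (x + y)" "col (idx x y) (x + y) = x"
proof -
  have "\<exists>!k. k \<le> level (x + y) \<and> col k (x + y) = x"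
    using col_surj[OF assms] col_inj[of _ "x + y"] by (metis (no_types))
  from theI'[OF this] show "idx x y \<le> level (x + y)" "col (idx x y) (x + y) = x"
    unfolding idx_def by auto
qed

lemma idx_eqI:
  assumes "k \<le> level (x + y)" "col k (x + y) = x"
  shows "idx x y = k"
  unfolding idx_def
proof (rule the_equality)
  show "k' = k" if "k' \<le> level (x + y) \<and> col k' (x + y) = x" for k'
    using that assms col_inj[of k' "x + y" k] by argo
qed (use assms in blast)

lemma idx_le: "x \<le> P \<Longrightarrow> y \<le> Q \<Longrightarrow> idx x y \<le> x + y \<and> x + y + idx x y \<le> P + Q"
  using idx(1)[of x y] by (auto simp: level_def)

lemma idx_rank:
  assumes "x \<le> P" "y \<le> Q" "idx x y \<le> r" "r + idx x y \<le> P + Q"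
  shows "\<exists>x'\<le>P. \<exists>y'\<le>Q. x' + y' = r \<and> idx x' y' = idx x y"
proof -
  let ?k = "idx x y"
  have k: "?k \<le> level r"
    using idx(1)[OF assms(1,2)] assms(3,4) by (auto simp: level_def)
  show ?thesis
    using col_bounds[OF k] assms(4) idx_eqI[of ?k "col ?k r" "r - col ?k r"] k
    by (intro exI[of _ "col ?k r"] conjI exI[of _ "r - col ?k r"]) auto
qed

lemma idx_mono:
  assumes "x \<le> P" "y \<le> Q" "x' \<le> P" "y' \<le> Q" "idx x y = idx x' y'" "x + y \<le> x' + y'"
  shows "x \<le> x' \<and> y \<le> y'"
  using col_mono[of "x + y" "x' + y'" "idx x y"] idx[of x y] idx[of x' y'] assms by auto

section \<open>Chains joining opposite sides of the grid\<close>

text \<open>The two ends of a row or column sit at the first position of one level and the last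
  position of another. Chain 0 leaves position 0 after level 0 and climbs no higher than 2, chain 1
  no higher than 1, and later chains never reach 0 except chain \<open>M\<close>, which has a single
  position.\<close>

lemma shift_0_and_max:
  assumes "2 \<le> M" "k \<le> e" "e \<le> M" "k \<le> d" "d \<le> M" "shift k e = 0" "shift k d = d"
  shows "e = 0 \<and> (d \<le> 1 \<or> d = 2 \<and> M = 2 \<and> v \<le> 1)"
proof -
  show ?thesis
  proof (cases k rule: nat_cases_0_1_ge2)
    case 1
    have base: "base k x = (if x = 0 then 0 else 1)" for x
      using assms(1) 1 by (simp add: base_def)
    have kM: "k \<noteq> M" using assms(1) 1 by linarith
    have "e = 0"
    proof (rule ccontr)
      assume "e \<noteq> 0"
      with kM have "shift k e \<noteq> 0" unfolding shift_def base by simp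
      with assms(6) show False by simp
    qed
    moreover have "d = 2 \<and> M = 2 \<and> v \<le> 1" if d: "\<not> d \<le> 1"
    proof -
      from d kM have "shift k d = (if d < M then 1 else if v \<le> 1 then 2 else 1)"
        unfolding shift_def base by simp
      with d assms(1,5,7) show ?thesis by (simp split: if_splits)
    qed
    ultimately show ?thesis by blast
  next
    case 2
    have base: "base k x = 0" for x
      using assms(1) 2 by (simp add: base_def)
    have "k \<noteq> M" using assms(1) 2 by linarith
    then have "shift k d = (if d < M then 0 else if v = 0 then 1 else 0)"
      unfolding shift_def base by simp
    then show ?thesis using assms(1,4,5,7) 2 by (simp split: if_splits)
  next
    case 3
    have base: "base k x = k" for x
      using 3 by (simp add: base_def)
    have k: "shift k x = (if x < M then k else if k = M then v else if v \<le> k then Suc k else k)" for x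
      unfolding shift_def base by simp
    have "k = M" "v = 0"
      using assms(6) 3 unfolding k by (simp_all split: if_splits)
    then show ?thesis using assms(1,4,5,7) unfolding k by (simp split: if_splits)
  qed
qed

text \<open>For \<open>M \<ge> 2\<close> only the exceptional case \<open>M = 2\<close>,
  \<open>v \<le> 1\<close> of \<open>shift_0_and_max\<close> is left, but \<open>P \<ge> 5\<close>
  gives \<open>v = 2\<close> there. So \<open>Q \<le> 1\<close>: for \<open>Q = 0\<close> there is
  one row, and for \<open>Q = 1\<close> the choice of \<open>v\<close> selects row
  \<open>t\<close>.\<close>

lemma idx_row:
  assumes "5 \<le> P" "j \<le> Q" "idx 0 j = idx P j"
  shows "j = t"
proof -
  define k where "k = idx 0 j"
  have k: "k \<le> level j" "k \<le> level (P + j)" "col k j = 0" "col k (P + j) = P"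
    using idx[of 0 j] idx[of P j] assms by (auto simp: k_def)
  have "level j = min P j" "level (P + j) = min P (Q - j)" "P + j - Q + min P (Q - j) = P"
    using assms by (auto simp: level_def M_def)
  then have "k \<le> min P j" "k \<le> min P (Q - j)" "shift k (min P j) = 0"
    "shift k (min P (Q - j)) = min P (Q - j)"
    using k assms(2) by (auto simp: col_def)
  note shift = this
  show ?thesis
  proof (cases "2 \<le> M")
    case True
    have "min P j \<le> M" "min P (Q - j) \<le> M" using assms(2) by (auto simp: M_def)
    with shift_0_and_max[OF True shift(1) _ shift(2) _ shift(3,4)]
    have "j = 0" "M = 2" "v \<le> 1"
      using True assms(1,2) by (auto simp: M_def min_def split: if_splits)
    moreover from this have "min P Q = 2" by (simp add: M_def)
    ultimately show ?thesis using assms(1) by (auto simp: v_def min_def split: if_splits)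
  next
    case False
    then have "Q = 0 \<or> Q = 1" "M = Q" using assms(1) by (auto simp: M_def)
    moreover from this assms(2) have "j = 0 \<or> j = 1 \<and> Q = 1" by auto
    moreover have "base k d = k" for d using False by (simp add: base_def)
    moreover have "Q = 1 \<Longrightarrow> v = t" unfolding v_def M_def using assms(1) by auto
    ultimately show ?thesis
      using assms(1,2) t_le shift unfolding shift_def by (auto split: if_splits)
  qed
qed

text \<open>As for \<open>idx_row\<close>, with first and last position exchanged;
  \<open>v = 1 - s\<close> selects the column when \<open>P = 1\<close>. The conclusion
  \<open>P \<le> 1\<close> is why the first factor needs colours only on chains of at most two
  sets.\<close>

lemma idx_column:
  assumes "5 \<le> Q" "x \<le> P" "idx x 0 = idx x Q"
  shows "x = s \<and> P \<le> 1"
proof -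
  define k where "k = idx x 0"
  have k: "k \<le> level x" "k \<le> level (x + Q)" "col k x = x" "col k (x + Q) = x"
    using idx[of x 0] idx[of x Q] assms by (auto simp: k_def)
  have "level x = min x Q" "level (x + Q) = min (P - x) Q" "x - Q + min x Q = x"
    using assms by (auto simp: level_def M_def)
  then have "k \<le> min x Q" "k \<le> min (P - x) Q" "shift k (min x Q) = min x Q"
    "shift k (min (P - x) Q) = 0"
    using k assms(2) by (auto simp: col_def)
  note shift = this
  show ?thesis
  proof (cases "2 \<le> M")
    case True
    have "min x Q \<le> M" "min (P - x) Q \<le> M" using assms(2) by (auto simp: M_def)
    with shift_0_and_max[OF True shift(2) _ shift(1) _ shift(4,3)]
    have "M = 2" "v \<le> 1"
      using True assms(1,2) by (auto simp: M_def min_def split: if_splits)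
    moreover from this have "min P Q = 2" by (simp add: M_def)
    ultimately show ?thesis using assms(1) by (auto simp: v_def min_def split: if_splits)
  next
    case False
    then have "P = 0 \<or> P = 1" "M = P" using assms(1) by (auto simp: M_def)
    moreover from this assms(2) have "x = 0 \<or> x = 1 \<and> P = 1" by auto
    moreover have "base k d = k" for d using False by (simp add: base_def)
    moreover have "P = 1 \<Longrightarrow> v = 1 - s" unfolding v_def M_def using assms(1) by auto
    ultimately show ?thesis
      using assms(1,2) s_le shift unfolding shift_def by (auto split: if_splits)
  qed
qed

text \<open>A chain of at most two points exists only if \<open>P\<close> and \<open>Q\<close>
  differ by at most 1, and is then chain \<open>M\<close>, which \<open>v\<close> places on row
  \<open>t\<close>.\<close>

lemma idx_shortest:
  assumes "x \<le> P" "y \<le> Q" "P + Q \<le> 2 * idx x y + 1"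
  shows "\<exists>x'\<le>P. idx x' t = idx x y"
proof -
  define k where "k = idx x y"
  have kM: "k \<le> M" using idx(1)[OF assms(1,2)] by (simp add: level_def k_def)
  then have k: "k = M" "P \<le> Suc Q" "Q \<le> Suc P"
    using assms(3) by (auto simp: M_def k_def)
  have "t \<le> M \<or> (t = Suc M \<and> Q = Suc M \<and> P = M)"
    using t_le k by (auto simp: M_def)
  then have "\<exists>x'\<le>P. k \<le> level (x' + t) \<and> col k (x' + t) = x'"
  proof
    assume "t \<le> M"
    then have "level (M - t + t) = M" "col M (M - t + t) = M - t"
      using k by (auto simp: col_def level_def M_def shift_def v_def)
    moreover have "M \<le> P" by (simp add: M_def)
    ultimately show ?thesis using k(1) by (intro exI[of _ "M - t"]) auto
  next
    \<comment> \<open>Here \<open>M - t\<close> truncates to 0: chain \<open>M\<close> is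
      \<open>(0, M)\<close>, \<open>(0, Suc M)\<close>, and its upper point lies in row
      \<open>t\<close>.\<close>
    assume "t = Suc M \<and> Q = Suc M \<and> P = M"
    then have t: "level t = M" "t - Q = 0" "M - t = 0"
      unfolding level_def by linarith+
    then have "v = 0" unfolding v_def using k(2,3) by simp
    then have "level t = M" "col M t = 0"
      using t by (simp_all add: col_def shift_def)
    then show ?thesis using k by (intro exI[of _ 0]) auto
  qed
  then show ?thesis using idx_eqI k_def by metis
qed

end

section \<open>Products of symmetric chain decompositions\<close>

text \<open>A symmetric chain decomposition of \<open>Pow U\<close> is encoded by a function \<open>f\<close> that is constant on each
  chain and separates the chains; \<open>l Z\<close> is the smallest rank of the chain through \<open>Z\<close>.\<close>

locale chain_labelling =
  fixes U :: "nat set" and f l :: "nat set \<Rightarrow> nat"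
  assumes finite_U: "finite U"
    and l_le: "Z \<subseteq> U \<Longrightarrow> l Z \<le> card Z"
    and l_le_codim: "Z \<subseteq> U \<Longrightarrow> card Z + l Z \<le> card U"
    and ex_rank: "Z \<subseteq> U \<Longrightarrow> l Z \<le> r \<Longrightarrow> r + l Z \<le> card U \<Longrightarrow> \<exists>Y\<subseteq>U. f Y = f Z \<and> card Y = r"
    and l_cong: "Y \<subseteq> U \<Longrightarrow> Z \<subseteq> U \<Longrightarrow> f Y = f Z \<Longrightarrow> l Y = l Z"
    and comparable: "Y \<subseteq> U \<Longrightarrow> Z \<subseteq> U \<Longrightarrow> f Y = f Z \<Longrightarrow> card Y \<le> card Z \<Longrightarrow> Y \<subseteq> Z"
begin

lemma eq_if_card_eq:
  "Y \<subseteq> U \<Longrightarrow> Z \<subseteq> U \<Longrightarrow> f Y = f Z \<Longrightarrow> card Y = card Z \<Longrightarrow> Y = Z"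
  using comparable by (metis order_refl subset_antisym)

lemma twice_l_le: "Z \<subseteq> U \<Longrightarrow> 2 * l Z \<le> card U"
  using l_le[of Z] l_le_codim[of Z] by linarith

lemma l_empty: "l {} = 0"
  using l_le[of "{}"] by simp

section \<open>Marked positions on a chain\<close>

definition marked :: "(nat set \<Rightarrow> bool) \<Rightarrow> nat set \<Rightarrow> bool" where
  "marked C Z \<longleftrightarrow> (\<exists>Y\<subseteq>U. f Y = f Z \<and> C Y)"

text \<open>The position on its chain of some set satisfying \<open>C\<close>; junk value 0 if there is none.\<close>

definition mark :: "(nat set \<Rightarrow> bool) \<Rightarrow> nat set \<Rightarrow> nat" where
  "mark C Z = (if marked C Z then card (SOME Y. Y \<subseteq> U \<and> f Y = f Z \<and> C Y) - l Z else 0)"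

lemma mark_cong: "Y \<subseteq> U \<Longrightarrow> Z \<subseteq> U \<Longrightarrow> f Y = f Z \<Longrightarrow> mark C Y = mark C Z"
  using l_cong[of Y Z] by (simp add: mark_def marked_def cong: if_cong)

lemma ex_mark:
  assumes "Z \<subseteq> U" "marked C Z"
  shows "\<exists>Y\<subseteq>U. f Y = f Z \<and> C Y \<and> card Y = l Z + mark C Z"
proof -
  define Y where "Y = (SOME Y. Y \<subseteq> U \<and> f Y = f Z \<and> C Y)"
  have Y: "Y \<subseteq> U \<and> f Y = f Z \<and> C Y"
    using assms(2) unfolding marked_def Y_def by (metis (mono_tags, lifting) someI_ex)
  then have "l Z \<le> card Y" using l_le[of Y] l_cong[of Y Z] assms(1) by simp
  then have "card Y = l Z + mark C Z"
    using assms(2) by (simp add: mark_def flip: Y_def)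
  then show ?thesis using Y by blast
qed

lemma mark_le:
  assumes "Z \<subseteq> U"
  shows "mark C Z \<le> card U - 2 * l Z"
proof (cases "marked C Z")
  case True
  then obtain Y where "Y \<subseteq> U" "f Y = f Z" "card Y = l Z + mark C Z"
    using ex_mark[OF assms] by blast
  then show ?thesis using l_le_codim[of Y] l_cong[of Y Z] assms by simp
qed (simp add: mark_def)

lemma at_mark:
  assumes "Z \<subseteq> U" "marked C Z" "card Z - l Z = mark C Z"
  shows "C Z"
proof -
  obtain Y where "Y \<subseteq> U" "f Y = f Z" "C Y" "card Y = l Z + mark C Z"
    using ex_mark[OF assms(1,2)] by blast
  moreover from this have "Y = Z"
    using eq_if_card_eq[of Y Z] l_le[of Z] assms(1,3) by simp
  ultimately show ?thesis by simp
qed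

end

locale labelling_product =
  A: chain_labelling U f l + B: chain_labelling V g m
  for U f l V g m +
  fixes C D :: "nat set \<Rightarrow> bool"
  assumes disjoint: "U \<inter> V = {}"
begin

text \<open>The chains through \<open>A\<close> and \<open>B\<close> span a grid with positions as
  coordinates; the marks give its distinguished column and row.\<close>

definition index :: "nat set \<Rightarrow> nat set \<Rightarrow> nat" where
  "index A B = grid.idx (card U - 2 * l A) (card V - 2 * m B) (A.mark C A) (B.mark D B)
     (card A - l A) (card B - m B)"

definition label :: "nat set \<Rightarrow> nat" where
  "label Z = prod_encode (prod_encode (f (Z \<inter> U), g (Z \<inter> V)), index (Z \<inter> U) (Z \<inter> V))"

definition depth :: "nat set \<Rightarrow> nat" where
  "depth Z = l (Z \<inter> U) + m (Z \<inter> V) + index (Z \<inter> U) (Z \<inter> V)"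

lemma grid:
  assumes "A \<subseteq> U" "B \<subseteq> V"
  shows "grid (card U - 2 * l A) (card V - 2 * m B) (A.mark C A) (B.mark D B)"
  using A.mark_le[OF assms(1)] B.mark_le[OF assms(2)] by unfold_locales

lemma coordinates_le:
  assumes "A \<subseteq> U" "B \<subseteq> V"
  shows "card A - l A \<le> card U - 2 * l A" "card B - m B \<le> card V - 2 * m B"
  using assms A.l_le_codim[of A] B.l_le_codim[of B] by auto

lemma card_Un: "A \<subseteq> U \<Longrightarrow> B \<subseteq> V \<Longrightarrow> card (A \<union> B) = card A + card B"
  using disjoint A.finite_U B.finite_U by (intro card_Un_disjoint) (auto intro: finite_subset)

lemma Un_Int [simp]:
  assumes "A \<subseteq> U" "B \<subseteq> V"
  shows "(A \<union> B) \<inter> U = A" "(A \<union> B) \<inter> V = B"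
  using assms disjoint by auto

lemma card_split: "Z \<subseteq> U \<union> V \<Longrightarrow> card Z = card (Z \<inter> U) + card (Z \<inter> V)"
  using card_Un[of "Z \<inter> U" "Z \<inter> V"] by (simp add: Int_Un_distrib[symmetric] Int_absorb2)

lemma label_eq_iff:
  "label Y = label Z \<longleftrightarrow> f (Y \<inter> U) = f (Z \<inter> U) \<and> g (Y \<inter> V) = g (Z \<inter> V) \<and>
     index (Y \<inter> U) (Y \<inter> V) = index (Z \<inter> U) (Z \<inter> V)"
  by (auto simp: label_def)

text \<open>Chain lengths and marks depend only on the chains, so a whole product of chains can be
  indexed in the grid of one representative.\<close>

lemma index_cong:
  assumes "A \<subseteq> U" "A' \<subseteq> U" "B \<subseteq> V" "B' \<subseteq> V" "f A' = f A" "g B' = g B"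
  shows "index A' B' = grid.idx (card U - 2 * l A) (card V - 2 * m B) (A.mark C A) (B.mark D B)
     (card A' - l A) (card B' - m B)"
  unfolding index_def
  using A.l_cong[of A' A] B.l_cong[of B' B] A.mark_cong[of A' A] B.mark_cong[of B' B] assms
  by simp

text \<open>Equal labels mean one chain of one grid, along which both coordinates are monotone;
  comparability in each factor turns ranks into inclusions.\<close>

lemma label_mono:
  assumes "Y \<subseteq> U \<union> V" "Z \<subseteq> U \<union> V" "label Y = label Z" "card Y \<le> card Z"
  shows "Y \<inter> U \<subseteq> Z \<inter> U" "Y \<inter> V \<subseteq> Z \<inter> V"
proof -
  let ?A = "Z \<inter> U" and ?B = "Z \<inter> V" and ?A' = "Y \<inter> U" and ?B' = "Y \<inter> V"
  interpret G: grid "card U - 2 * l ?A" "card V - 2 * m ?B" "A.mark C ?A" "B.mark D ?B"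
    by (rule grid) auto
  have f: "f ?A' = f ?A" "g ?B' = g ?B" and i: "index ?A' ?B' = index ?A ?B"
    using assms(3) by (simp_all add: label_eq_iff)
  have lm: "l ?A' = l ?A" "m ?B' = m ?B" using A.l_cong B.l_cong f by auto
  have le: "l ?A' \<le> card ?A'" "m ?B' \<le> card ?B'" "l ?A \<le> card ?A" "m ?B \<le> card ?B"
    using A.l_le B.l_le by auto
  have "card ?A' - l ?A \<le> card ?A - l ?A \<and> card ?B' - m ?B \<le> card ?B - m ?B"
  proof (rule G.idx_mono)
    show "G.idx (card ?A' - l ?A) (card ?B' - m ?B) = G.idx (card ?A - l ?A) (card ?B - m ?B)"
      using i index_cong[of ?A ?A' ?B ?B'] index_cong[of ?A ?A ?B ?B] f by simp
    show "card ?A' - l ?A + (card ?B' - m ?B) \<le> card ?A - l ?A + (card ?B - m ?B)"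
      using card_split[OF assms(1)] card_split[OF assms(2)] assms(4) le lm by linarith
  qed (use coordinates_le[of ?A ?B] coordinates_le[of ?A' ?B'] lm in auto)
  then have "card ?A' \<le> card ?A" "card ?B' \<le> card ?B" using le lm by linarith+
  then show "?A' \<subseteq> ?A" "?B' \<subseteq> ?B"
    using A.comparable[of ?A' ?A] B.comparable[of ?B' ?B] f by blast+
qed

lemma ex_coordinates:
  assumes "A \<subseteq> U" "B \<subseteq> V" "x \<le> card U - 2 * l A" "y \<le> card V - 2 * m B"
  obtains A' B' where "A' \<subseteq> U" "B' \<subseteq> V" "f A' = f A" "g B' = g B"
    "card A' = l A + x" "card B' = m B + y"
proof -
  have "2 * l A \<le> card U" "2 * m B \<le> card V"
    using A.twice_l_le B.twice_l_le assms(1,2) by blast+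
  then have "l A + x + l A \<le> card U" "m B + y + m B \<le> card V"
    using assms(3,4) by linarith+
  then show ?thesis
    using A.ex_rank[OF assms(1) le_add1] B.ex_rank[OF assms(2) le_add1] that by metis
qed

text \<open>Grid chain \<open>k\<close> starts at rank \<open>l + m + k\<close>. Since
  \<open>P + Q + 2 * (l + m) = card U + card V\<close>, symmetry in the grid is symmetry in the
  product.\<close>

lemma chain_labelling: "chain_labelling (U \<union> V) label depth"
proof
  show "finite (U \<union> V)" using A.finite_U B.finite_U by simp
next
  fix Z assume Z: "Z \<subseteq> U \<union> V"
  let ?A = "Z \<inter> U" and ?B = "Z \<inter> V"
  interpret G: grid "card U - 2 * l ?A" "card V - 2 * m ?B" "A.mark C ?A" "B.mark D ?B"
    by (rule grid) auto
  have le: "l ?A \<le> card ?A" "m ?B \<le> card ?B" "card ?A + l ?A \<le> card U" "card ?B + m ?B \<le> card V"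
    using A.l_le B.l_le A.l_le_codim B.l_le_codim by auto
  have UV: "card (U \<union> V) = card U + card V" using card_Un by blast
  have i: "index ?A ?B \<le> card ?A - l ?A + (card ?B - m ?B)"
    "card ?A - l ?A + (card ?B - m ?B) + index ?A ?B \<le> card U - 2 * l ?A + (card V - 2 * m ?B)"
    using G.idx_le[OF coordinates_le[of ?A ?B]] by (auto simp: index_def)
  show "depth Z \<le> card Z" "card Z + depth Z \<le> card (U \<union> V)"
    unfolding depth_def UV using card_split[OF Z] le i by linarith+
  show "\<exists>Y\<subseteq>U \<union> V. label Y = label Z \<and> card Y = r"
    if r: "depth Z \<le> r" "r + depth Z \<le> card (U \<union> V)" for r
  proof -
    have "\<exists>x'\<le>card U - 2 * l ?A. \<exists>y'\<le>card V - 2 * m ?B. x' + y' = r - l ?A - m ?B \<and>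
       G.idx x' y' = G.idx (card ?A - l ?A) (card ?B - m ?B)"
      by (rule G.idx_rank) (use coordinates_le[of ?A ?B] r le in
        \<open>auto simp: depth_def UV simp flip: index_def\<close>)
    then obtain x y where xy: "x \<le> card U - 2 * l ?A" "y \<le> card V - 2 * m ?B"
      "x + y = r - l ?A - m ?B" "G.idx x y = index ?A ?B"
      by (auto simp: index_def)
    obtain A' B' where AB: "A' \<subseteq> U" "B' \<subseteq> V" "f A' = f ?A" "g B' = g ?B"
      "card A' = l ?A + x" "card B' = m ?B + y"
      using ex_coordinates[of ?A ?B x y] xy by auto
    have "index A' B' = index ?A ?B"
      using index_cong[of ?A A' ?B B'] AB xy(4) by simp
    moreover have "card (A' \<union> B') = r"
      using card_Un[OF AB(1,2)] AB(5,6) xy(3) r(1) by (simp add: depth_def)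
    ultimately show ?thesis
      using AB by (intro exI[of _ "A' \<union> B'"]) (auto simp: label_eq_iff)
  qed
next
  fix Y Z assume YZ: "Y \<subseteq> U \<union> V" "Z \<subseteq> U \<union> V" "label Y = label Z"
  then show "depth Y = depth Z"
    using A.l_cong[of "Y \<inter> U" "Z \<inter> U"] B.l_cong[of "Y \<inter> V" "Z \<inter> V"]
    by (simp add: depth_def label_eq_iff)
  show "Y \<subseteq> Z" if "card Y \<le> card Z"
    using label_mono[OF YZ that] YZ(1) by blast
qed

section \<open>Colours of bad pairs and of short chains\<close>

text \<open>The chain of \<open>{}\<close> in \<open>U\<close> has all ranks, so
  \<open>idx_row\<close> applies with \<open>P = card U\<close>: the common row is the marked
  one.\<close>

lemma same_row:
  assumes "5 \<le> card U" "f {} = f U" "B \<subseteq> V" "B.marked D B" "label B = label (U \<union> B)"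
  shows "D B"
proof -
  have l: "l {} = 0" "l U = 0" using A.l_empty A.l_cong[of "{}" U] assms(2) by auto
  interpret G: grid "card U" "card V - 2 * m B" "A.mark C {}" "B.mark D B"
    using grid[of "{}" B] assms(3) l by simp
  have "B \<inter> U = {}" "B \<inter> V = B" using assms(3) disjoint by auto
  then have "index {} B = index U B"
    using assms(3,5) by (simp add: label_eq_iff)
  then have "G.idx 0 (card B - m B) = G.idx (card U) (card B - m B)"
    using index_cong[of "{}" "{}" B B] index_cong[of "{}" U B B] assms(2,3) l by simp
  then have "card B - m B = B.mark D B"
    using G.idx_row assms(1) coordinates_le(2)[of "{}" B] assms(3) by blast
  then show ?thesis using B.at_mark assms(3,4) by blast
qed

text \<open>By \<open>idx_column\<close> the bad pair lies in the marked column of a grid with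
  \<open>P \<le> 1\<close>, that is, over a chain of at most two sets, so a mark is demanded only
  there.\<close>

lemma same_column:
  assumes "5 \<le> card V" "g {} = g V" "A \<subseteq> U" "card U \<le> 2 * l A + 1 \<Longrightarrow> A.marked C A"
    "label A = label (A \<union> V)"
  shows "C A"
proof -
  have l: "m {} = 0" "m V = 0" using B.l_empty B.l_cong[of "{}" V] assms(2) by auto
  interpret G: grid "card U - 2 * l A" "card V" "A.mark C A" "B.mark D {}"
    using grid[of A "{}"] assms(3) l by simp
  have "A \<inter> U = A" "A \<inter> V = {}" using assms(3) disjoint by auto
  then have "index A {} = index A V"
    using assms(3,5) by (simp add: label_eq_iff)
  then have "G.idx (card A - l A) 0 = G.idx (card A - l A) (card V)"
    using index_cong[of A A "{}" "{}"] index_cong[of A A "{}" V] assms(2,3) l by simp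
  then have "card A - l A = A.mark C A \<and> card U - 2 * l A \<le> 1"
    using G.idx_column assms(1) coordinates_le(1)[of A "{}"] assms(3) by blast
  moreover from this have "A.marked C A" using assms(4) by linarith
  ultimately show ?thesis using A.at_mark assms(3) by blast
qed

text \<open>The rank bound leaves at most two points on the grid chain, which then meets the marked
  row by \<open>idx_shortest\<close>. Hence colouring the product by its \<open>V\<close> part
  colours all short chains.\<close>

lemma ex_marked:
  assumes "Z \<subseteq> U \<union> V" "card (U \<union> V) \<le> 2 * depth Z + 1" "B.marked D (Z \<inter> V)"
  shows "\<exists>Y\<subseteq>U \<union> V. label Y = label Z \<and> D (Y \<inter> V)"
proof -
  let ?A = "Z \<inter> U" and ?B = "Z \<inter> V"
  interpret G: grid "card U - 2 * l ?A" "card V - 2 * m ?B" "A.mark C ?A" "B.mark D ?B"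
    by (rule grid) auto
  have "card (U \<union> V) = card U + card V" using card_Un by blast
  then have "\<exists>x'\<le>card U - 2 * l ?A.
      G.idx x' (B.mark D ?B) = G.idx (card ?A - l ?A) (card ?B - m ?B)"
  proof (intro G.idx_shortest)
    show "card U - 2 * l ?A + (card V - 2 * m ?B)
        \<le> 2 * G.idx (card ?A - l ?A) (card ?B - m ?B) + 1"
      using assms(2) \<open>card (U \<union> V) = _\<close> A.twice_l_le[of ?A] B.twice_l_le[of ?B]
      unfolding depth_def index_def by simp
  qed (use coordinates_le[of ?A ?B] in auto)
  then obtain x where x: "x \<le> card U - 2 * l ?A" "G.idx x (B.mark D ?B) = index ?A ?B"
    by (auto simp: index_def)
  obtain A' where A': "A' \<subseteq> U" "f A' = f ?A" "card A' = l ?A + x"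
    using ex_coordinates[of ?A ?B x 0] x(1) by (metis Int_lower2 le0)
  obtain B' where B': "B' \<subseteq> V" "g B' = g ?B" "D B'" "card B' = m ?B + B.mark D ?B"
    using B.ex_mark[of ?B D] assms(3) by (metis Int_lower2)
  have "index A' B' = index ?A ?B"
    using index_cong[of ?A A' ?B B'] A' B' x(2) by simp
  then show ?thesis
    using A' B' by (intro exI[of _ "A' \<union> B'"]) (auto simp: label_eq_iff)
qed

end

section \<open>Coloured triples\<close>

text \<open>For chain labellings, sets with a common label are comparable, so only pairs
  \<open>Y \<subset> Z\<close> matter.\<close>

definition orthogonal :: "nat set \<Rightarrow> (nat set \<Rightarrow> nat) \<Rightarrow> (nat set \<Rightarrow> nat) \<Rightarrow> bool" where
  "orthogonal U f g \<longleftrightarrow>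
     (\<forall>Y Z. Y \<subset> Z \<longrightarrow> Z \<subseteq> U \<longrightarrow> f Y = f Z \<longrightarrow> g Y = g Z \<longrightarrow> Y = {} \<and> Z = U)"

lemma orthogonalD:
  "orthogonal U f g \<Longrightarrow> Y \<subset> Z \<Longrightarrow> Z \<subseteq> U \<Longrightarrow> f Y = f Z \<Longrightarrow> g Y = g Z \<Longrightarrow> Y = {} \<and> Z = U"
  unfolding orthogonal_def by (elim allE impE)

text \<open>\<open>card U \<le> 2 * l i Z + 1\<close> says that the chain has at most two sets. This
  weak form is what products inherit.\<close>

definition coloured_triple ::
  "bool \<Rightarrow> nat set \<Rightarrow> (nat \<Rightarrow> nat set \<Rightarrow> nat) \<Rightarrow> (nat \<Rightarrow> nat set \<Rightarrow> nat) \<Rightarrow> (nat set \<Rightarrow> nat) \<Rightarrow> bool" where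
  "coloured_triple strong U f l c \<longleftrightarrow>
     (\<forall>i<3. chain_labelling U (f i) (l i) \<and>
       (\<forall>Z\<subseteq>U. strong \<or> card U \<le> 2 * l i Z + 1 \<longrightarrow> (\<exists>Y\<subseteq>U. f i Y = f i Z \<and> c Y = i))) \<and>
     (\<forall>i<3. \<forall>j<3. i \<noteq> j \<longrightarrow> orthogonal U (f i) (f j))"

lemma coloured_tripleD:
  assumes "coloured_triple strong U f l c" "i < 3"
  shows "chain_labelling U (f i) (l i)"
    "Z \<subseteq> U \<Longrightarrow> strong \<or> card U \<le> 2 * l i Z + 1 \<Longrightarrow> \<exists>Y\<subseteq>U. f i Y = f i Z \<and> c Y = i"
    "i \<noteq> j \<Longrightarrow> j < 3 \<Longrightarrow> orthogonal U (f i) (f j)"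
  using assms by (auto simp: coloured_triple_def)

lemma coloured_triple_weaken: "coloured_triple True U f l c \<Longrightarrow> coloured_triple False U f l c"
  by (auto simp: coloured_triple_def)

lemma (in chain_labelling) same_label_subset:
  assumes "Y \<subseteq> U" "Z \<subseteq> U" "f Y = f Z"
  shows "Y \<subseteq> Z \<or> Z \<subseteq> Y"
  using assms comparable[of Y Z] comparable[of Z Y] by (metis nat_le_linear)

text \<open>A pair on a chain of both the \<open>i\<close>-th and the \<open>j\<close>-th product
  projects in each factor to equal sets or to \<open>{}\<close> and the whole. Only the mixed cases
  are harmful, and there the common projection would have colours \<open>i\<close> and
  \<open>j\<close> at once.\<close>

lemma coloured_triple_Un:
  assumes W: "coloured_triple False U f l c" and S: "coloured_triple True V g m d"
    and disj: "U \<inter> V = {}" and card: "5 \<le> card U" "5 \<le> card V"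
  shows "\<exists>h k e. coloured_triple False (U \<union> V) h k e"
proof -
  define h where "h i = labelling_product.label U (f i) (l i) V (g i) (m i) (\<lambda>Y. c Y = i) (\<lambda>Y. d Y = i)" for i
  define k where "k i = labelling_product.depth U (f i) (l i) V (g i) (m i) (\<lambda>Y. c Y = i) (\<lambda>Y. d Y = i)" for i
  define e where "e Z = d (Z \<inter> V)" for Z
  have P: "labelling_product U (f i) (l i) V (g i) (m i)" if "i < 3" for i
    using coloured_tripleD(1)[OF W that] coloured_tripleD(1)[OF S that] disj
    by (simp add: labelling_product_def labelling_product_axioms_def)
  have lab: "chain_labelling (U \<union> V) (h i) (k i)" if "i < 3" for i
    unfolding h_def k_def using labelling_product.chain_labelling[OF P[OF that]] by blast
  have marked: "chain_labelling.marked V (g i) (\<lambda>Y. d Y = i) B" if "i < 3" "B \<subseteq> V" for i B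
    using coloured_tripleD(2)[OF S that] coloured_tripleD(1)[OF S that(1)]
    by (simp add: chain_labelling.marked_def)
  have colour: "\<exists>Y\<subseteq>U \<union> V. h i Y = h i Z \<and> e Y = i"
    if "i < 3" "Z \<subseteq> U \<union> V" "card (U \<union> V) \<le> 2 * k i Z + 1" for i Z
    using labelling_product.ex_marked[OF P[OF that(1)] that(2), of "\<lambda>Y. c Y = i" "\<lambda>Y. d Y = i"]
      that marked[OF that(1), of "Z \<inter> V"] by (simp add: h_def k_def e_def)
  have row: "d B = i"
    if "i < 3" "f i {} = f i U" "B \<subseteq> V" "h i B = h i (U \<union> B)" for i B
    using labelling_product.same_row[OF P[OF that(1)] card(1) that(2,3)
        marked[OF that(1,3)]] that(4) by (simp add: h_def)
  have column: "c A = i"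
    if "i < 3" "g i {} = g i V" "A \<subseteq> U" "h i A = h i (A \<union> V)" for i A
    using labelling_product.same_column[OF P[OF that(1)] card(2) that(2,3), of "\<lambda>Y. c Y = i"]
      that(4) coloured_tripleD(2)[OF W that(1,3)] coloured_tripleD(1)[OF W that(1)]
    by (simp add: h_def chain_labelling.marked_def)
  have split: "f i (Y \<inter> U) = f i (Z \<inter> U) \<and> g i (Y \<inter> V) = g i (Z \<inter> V)"
    if "i < 3" "h i Y = h i Z" for i Y Z
    using that(2) by (simp add: h_def labelling_product.label_eq_iff[OF P[OF that(1)]])
  have "orthogonal (U \<union> V) (h i) (h j)" if ij: "i < 3" "j < 3" "i \<noteq> j" for i j
    unfolding orthogonal_def
  proof (intro allI impI)
    fix Y Z assume YZ: "Y \<subset> Z" "Z \<subseteq> U \<union> V" and h: "h i Y = h i Z" "h j Y = h j Z"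
    \<comment> \<open>Product labels determine the labels of both projections, so orthogonality
      within each factor applies.\<close>
    have U: "Y \<inter> U = Z \<inter> U \<or> Y \<inter> U = {} \<and> Z \<inter> U = U"
      using coloured_tripleD(3)[OF W ij(1,3,2)] split[OF ij(1) h(1)] split[OF ij(2) h(2)] YZ
      unfolding orthogonal_def by (metis Int_lower2 Int_mono order_refl psubsetE psubsetI)
    have V: "Y \<inter> V = Z \<inter> V \<or> Y \<inter> V = {} \<and> Z \<inter> V = V"
      using coloured_tripleD(3)[OF S ij(1,3,2)] split[OF ij(1) h(1)] split[OF ij(2) h(2)] YZ
      unfolding orthogonal_def by (metis Int_lower2 Int_mono order_refl psubsetE psubsetI)
    consider "Y \<inter> U = Z \<inter> U" "Y \<inter> V = Z \<inter> V" | "Y \<inter> U = {}" "Z \<inter> U = U" "Y \<inter> V = Z \<inter> V"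
      | "Y \<inter> U = Z \<inter> U" "Y \<inter> V = {}" "Z \<inter> V = V"
      | "Y \<inter> U = {}" "Z \<inter> U = U" "Y \<inter> V = {}" "Z \<inter> V = V"
      using U V by meson
    then show "Y = {} \<and> Z = U \<union> V"
    proof cases
      case 1
      then show ?thesis using YZ by blast
    next
      case 2
      then have Y: "Y \<subseteq> V" "Z = U \<union> Y" using YZ by blast+
      have "d Y = i"
        using row[OF ij(1) _ Y(1)] split[OF ij(1) h(1)] h(1) 2 Y(2) by simp
      moreover have "d Y = j"
        using row[OF ij(2) _ Y(1)] split[OF ij(2) h(2)] h(2) 2 Y(2) by simp
      ultimately show ?thesis using ij(3) by simp
    next
      case 3
      then have Y: "Y \<subseteq> U" "Z = Y \<union> V" using YZ by blast+
      have "c Y = i"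
        using column[OF ij(1) _ Y(1)] split[OF ij(1) h(1)] h(1) 3 Y(2) by simp
      moreover have "c Y = j"
        using column[OF ij(2) _ Y(1)] split[OF ij(2) h(2)] h(2) 3 Y(2) by simp
      ultimately show ?thesis using ij(3) by simp
    next
      case 4
      then show ?thesis using YZ by blast
    qed
  qed
  then have "coloured_triple False (U \<union> V) h k e"
    using lab colour by (simp add: coloured_triple_def)
  then show ?thesis by blast
qed

section \<open>Transport to other ground sets\<close>

lemma chain_labelling_image:
  assumes "chain_labelling U f l" and b: "bij_betw b V U"
  shows "chain_labelling V (\<lambda>Z. f (b ` Z)) (\<lambda>Z. l (b ` Z))"
proof -
  interpret chain_labelling U f l by fact
  have inj: "inj_on b V" and im: "b ` V = U" using b by (auto simp: bij_betw_def)
  have card: "card (b ` Z) = card Z" if "Z \<subseteq> V" for Z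
    using card_image inj_on_subset[OF inj that] by blast
  have sub: "b ` Z \<subseteq> U" if "Z \<subseteq> V" for Z using that im by blast
  have V: "card V = card U" "finite V" using bij_betw_same_card[OF b] bij_betw_finite[OF b] finite_U by auto
  show ?thesis
  proof
    fix Z r assume Z: "Z \<subseteq> V" and r: "l (b ` Z) \<le> r" "r + l (b ` Z) \<le> card V"
    obtain Y where Y: "Y \<subseteq> U" "f Y = f (b ` Z)" "card Y = r"
      using ex_rank[OF sub[OF Z] r(1)] r(2) V by auto
    then obtain X where "X \<subseteq> V" "Y = b ` X" using im by (metis subset_imageE)
    then show "\<exists>Y\<subseteq>V. f (b ` Y) = f (b ` Z) \<and> card Y = r" using Y card by auto
  next
    fix Y Z assume YZ: "Y \<subseteq> V" "Z \<subseteq> V" "f (b ` Y) = f (b ` Z)"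
    show "l (b ` Y) = l (b ` Z)" using l_cong[OF sub sub] YZ by blast
    assume "card Y \<le> card Z"
    then have "b ` Y \<subseteq> b ` Z" using comparable[OF sub sub] YZ card by simp
    then show "Y \<subseteq> Z" using inj_on_image_mem_iff[OF inj _ YZ(2)] YZ(1) by blast
  next
    fix Z assume Z: "Z \<subseteq> V"
    show "l (b ` Z) \<le> card Z" "card Z + l (b ` Z) \<le> card V"
      using l_le[OF sub[OF Z]] l_le_codim[OF sub[OF Z]] card[OF Z] V(1) by simp_all
  qed (fact V)
qed

lemma coloured_triple_image:
  assumes T: "coloured_triple strong U f l c" and b: "bij_betw b V U"
  shows "coloured_triple strong V (\<lambda>i Z. f i (b ` Z)) (\<lambda>i Z. l i (b ` Z)) (\<lambda>Z. c (b ` Z))"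
proof -
  have inj: "inj_on b V" and im: "b ` V = U" using b by (auto simp: bij_betw_def)
  have V: "card V = card U" using bij_betw_same_card[OF b] .
  have "\<exists>Y\<subseteq>V. f i (b ` Y) = f i (b ` Z) \<and> c (b ` Y) = i"
    if Z: "i < 3" "Z \<subseteq> V" "strong \<or> card V \<le> 2 * l i (b ` Z) + 1" for i Z
  proof -
    have "b ` Z \<subseteq> U" using Z(2) im by blast
    then obtain Y where "Y \<subseteq> U" "f i Y = f i (b ` Z)" "c Y = i"
      using coloured_tripleD(2)[OF T Z(1)] Z(3) V by metis
    moreover from this obtain X where "X \<subseteq> V" "Y = b ` X" using im by (metis subset_imageE)
    ultimately show ?thesis by blast
  qed
  moreover have "orthogonal V (\<lambda>Z. f i (b ` Z)) (\<lambda>Z. f j (b ` Z))"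
    if ij: "i < 3" "j < 3" "i \<noteq> j" for i j
    unfolding orthogonal_def
  proof (intro allI impI)
    fix Y Z assume YZ: "Y \<subset> Z" "Z \<subseteq> V" "f i (b ` Y) = f i (b ` Z)" "f j (b ` Y) = f j (b ` Z)"
    have psub: "b ` Y \<subset> b ` Z" using YZ(1,2) inj_on_image_eq_iff[OF inj, of Y Z] by auto
    have sub: "b ` Z \<subseteq> U" using YZ(2) im by blast
    from orthogonalD[OF coloured_tripleD(3)[OF T ij(1,3,2)] psub sub YZ(3,4)]
    have "b ` Y = {} \<and> b ` Z = U" .
    then have "Y = {}" "b ` Z = b ` V" using im by auto
    then show "Y = {} \<and> Z = V" using inj_on_image_eq_iff[OF inj YZ(2) order_refl] by simp
  qed
  ultimately show ?thesis
    using chain_labelling_image[OF coloured_tripleD(1)[OF T] b] by (simp add: coloured_triple_def)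
qed

text \<open>Ranging over all \<open>U\<close> allows any splitting of a given set into two
  factors.\<close>

definition all_coloured :: "bool \<Rightarrow> nat \<Rightarrow> bool" where
  "all_coloured strong n \<longleftrightarrow> (\<forall>U. card U = n \<longrightarrow> (\<exists>f l c. coloured_triple strong U f l c))"

lemma all_coloured_weaken: "all_coloured True n \<Longrightarrow> all_coloured False n"
  unfolding all_coloured_def using coloured_triple_weaken by blast

lemma all_coloured_add:
  assumes "all_coloured False p" "all_coloured True q" "5 \<le> p" "5 \<le> q"
  shows "all_coloured False (p + q)"
  unfolding all_coloured_def
proof (intro allI impI)
  fix Z :: "nat set" assume Z: "card Z = p + q"
  obtain U where U: "U \<subseteq> Z" "card U = p" "finite U"
    using obtain_subset_with_card_n[of p Z] Z by auto
  have "card (Z - U) = q" using card_Diff_subset[OF U(3,1)] U(2) Z by simp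
  moreover obtain f l c where "coloured_triple False U f l c"
    using assms(1) U(2) unfolding all_coloured_def by blast
  moreover obtain g m d where "coloured_triple True (Z - U) g m d"
    using assms(2) \<open>card (Z - U) = q\<close> unfolding all_coloured_def by blast
  moreover have "U \<inter> (Z - U) = {}" "U \<union> (Z - U) = Z" using U(1) by blast+
  ultimately show "\<exists>f l c. coloured_triple False Z f l c"
    using coloured_triple_Un[of U f l c "Z - U" g m d] U(2) assms(3,4) by simp
qed

text \<open>23 is the largest number that is not a sum of fives and sevens; 24 to 28 start an
  induction in steps of 5. Blocks are added singly because the second summand in
  \<open>all_coloured_add\<close> must be strong, while sums are only shown to be weak.\<close>

lemma all_coloured_ge_24:
  assumes five: "all_coloured True 5" and seven: "all_coloured True 7" and "24 \<le> n"
  shows "all_coloured False n"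
  using \<open>24 \<le> n\<close>
proof (induction n rule: less_induct)
  case (less n)
  have add: "all_coloured False (p + 5)" "all_coloured False (p + 7)"
    if "all_coloured False p" "5 \<le> p" for p
    using all_coloured_add[OF that(1) five that(2)] all_coloured_add[OF that(1) seven that(2)] by auto
  have 5: "all_coloured False 5" and 7: "all_coloured False 7"
    using five seven all_coloured_weaken by blast+
  have 10: "all_coloured False 10" and 12: "all_coloured False 12" and 14: "all_coloured False 14"
    using add[OF 5] add[OF 7] by simp_all
  have 15: "all_coloured False 15" and 17: "all_coloured False 17" and 19: "all_coloured False 19"
    and 21: "all_coloured False 21"
    using add[OF 10] add[OF 12] add[OF 14] by simp_all
  have "all_coloured False 20" using add[OF 15] by simp
  then have "all_coloured False 24" "all_coloured False 25" "all_coloured False 26"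
    "all_coloured False 27" "all_coloured False 28"
    using add[of 20] add[OF 17] add[OF 19] add[OF 21] by simp_all
  moreover have "n = 24 \<or> n = 25 \<or> n = 26 \<or> n = 27 \<or> n = 28 \<or> 24 \<le> n - 5"
    using less.prems by linarith
  moreover have "all_coloured False n" if "24 \<le> n - 5"
    using add(1)[of "n - 5"] less.IH[of "n - 5"] that by simp
  ultimately show ?case by blast
qed

section \<open>Coloured triples for 5 and 7 points\<close>

lemma (in chain_labelling) label_empty: "f {} = f U"
proof -
  obtain Y where "Y \<subseteq> U" "f Y = f {}" "card Y = card U"
    using ex_rank[of "{}" "card U"] l_empty by auto
  then show ?thesis using card_subset_eq[OF finite_U] by metis
qed

text \<open>If \<open>Y = {}\<close> and \<open>Z \<noteq> U\<close>, then \<open>Z\<close> and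
  \<open>U\<close> share both labels too, since \<open>{}\<close> and \<open>U\<close> do; the
  hypothesis for this pair gives \<open>Z = {}\<close>, a contradiction.\<close>

lemma orthogonalI:
  assumes f: "chain_labelling U f l" and g: "chain_labelling U g m"
    and neq: "\<And>Y Z. Y \<subset> Z \<Longrightarrow> Z \<subseteq> U \<Longrightarrow> f Y = f Z \<Longrightarrow> g Y = g Z \<Longrightarrow> Y = {}"
  shows "orthogonal U f g"
  unfolding orthogonal_def
proof (intro allI impI)
  fix Y Z assume YZ: "Y \<subset> Z" "Z \<subseteq> U" "f Y = f Z" "g Y = g Z"
  have Y: "Y = {}" using neq[OF YZ] .
  moreover have "Z = U"
  proof (rule ccontr)
    assume "Z \<noteq> U"
    then have "Z \<subset> U" using YZ(2) by blast
    moreover have "f Z = f U" "g Z = g U"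
      using chain_labelling.label_empty[OF f] chain_labelling.label_empty[OF g] YZ(3,4) Y by simp_all
    ultimately have "Z = {}" using neq[of Z U] by simp
    then show False using YZ(1) by simp
  qed
  ultimately show "Y = {} \<and> Z = U" by simp
qed

lemma orthogonal_sym: "orthogonal U f g \<Longrightarrow> orthogonal U g f"
  by (simp add: orthogonal_def)

section \<open>Chains encoded by lists of points\<close>

text \<open>Bit masks as integers, whose binary code equations keep the evaluation of the data
  cheap.\<close>

definition encode :: "nat set \<Rightarrow> int" where
  "encode S = (\<Sum>x\<in>S. 2 ^ x)"

lemma encode_inj:
  assumes "finite S" "finite T" "encode S = encode T"
  shows "S = T"
proof -
  have "encode S = int (set_encode S)" for S by (simp add: encode_def set_encode_def)
  then show ?thesis using assms inj_onD[OF inj_on_set_encode] by simp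
qed

lemma encode_eq_0: "finite S \<Longrightarrow> encode S = 0 \<Longrightarrow> S = {}"
  using encode_inj[of S "{}"] by (simp add: encode_def)

primrec prefix_codes :: "int \<Rightarrow> nat list \<Rightarrow> int list" where
  "prefix_codes a [] = [a]"
| "prefix_codes a (x # xs) = a # prefix_codes (a + 2 ^ x) xs"

lemma prefix_codes_eq:
  "distinct w \<Longrightarrow> prefix_codes a w = map (\<lambda>r. a + encode (set (take r w))) [0..<Suc (length w)]"
proof (induction w arbitrary: a)
  case Nil
  then show ?case by (simp add: encode_def)
next
  case (Cons x w)
  have "encode (insert x (set (take r w))) = 2 ^ x + encode (set (take r w))" for r
    using Cons.prems in_set_takeD[of x r w] unfolding encode_def by (intro sum.insert) auto
  moreover have "[0..<Suc (length (x # w))] = 0 # map Suc [0..<Suc (length w)]"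
    by (metis length_Cons map_Suc_upt upt_conv_Cons zero_less_Suc)
  ultimately show ?case
    using Cons by (simp add: encode_def o_def add.assoc del: upt_Suc)
qed

definition chain_codes :: "nat \<Rightarrow> nat list \<Rightarrow> int list" where
  "chain_codes n w = drop (n - length w) (prefix_codes 0 w)"

definition members :: "nat \<Rightarrow> nat list \<Rightarrow> nat set set" where
  "members n w = (\<lambda>r. set (take r w)) ` {n - length w..length w}"

lemma set_chain_codes: "distinct w \<Longrightarrow> set (chain_codes n w) = encode ` members n w"
  by (simp add: chain_codes_def prefix_codes_eq drop_map members_def image_image
      atLeastLessThanSuc_atLeastAtMost del: upt_Suc)

text \<open>An entry \<open>(m, w)\<close> stands for the chain of prefixes of \<open>w\<close> of lengths
  \<open>n - length w, \<dots>, length w\<close>, in which the prefix of length \<open>m\<close> carries the colour.\<close>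

definition valid_chain :: "nat \<Rightarrow> nat \<times> nat list \<Rightarrow> bool" where
  "valid_chain n = (\<lambda>(m, w). distinct w \<and> (\<forall>x\<in>set w. x < n) \<and> n \<le> 2 * length w \<and>
     n - length w \<le> m \<and> m \<le> length w)"

text \<open>Covering is replaced by counting: \<open>2 ^ n\<close> distinct codes of subsets exhaust
  the power set, which \<open>ex_members\<close> exploits.\<close>

definition valid_decomposition :: "nat \<Rightarrow> (nat \<times> nat list) list \<Rightarrow> bool" where
  "valid_decomposition n D \<longleftrightarrow> (\<forall>p\<in>set D. valid_chain n p) \<and>
     (let zs = concat (map (\<lambda>p. chain_codes n (snd p)) D) in distinct zs \<and> int (length zs) = 2 ^ n)"

lemma distinct_concat_nth:
  assumes "distinct (concat (map g xs))" "i < length xs" "j < length xs"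
    "z \<in> set (g (xs ! i))" "z \<in> set (g (xs ! j))"
  shows "i = j"
  using assms
proof (induction xs arbitrary: i j)
  case (Cons x xs)
  have no: "z \<notin> set (g (xs ! k))" if "z \<in> set (g x)" "k < length xs" for k
    using Cons.prems(1) that nth_mem[OF that(2)] by (simp add: disjoint_iff)
  show ?case
    using Cons.IH[of "i - 1" "j - 1"] Cons.prems no[of "i - 1"] no[of "j - 1"]
    by (cases i; cases j) simp_all
qed simp

text \<open>\<open>LEAST\<close> serves as a choice operator: in a valid decomposition the chain is
  unique by \<open>members_unique\<close>.\<close>

definition chain_index :: "nat \<Rightarrow> (nat \<times> nat list) list \<Rightarrow> nat set \<Rightarrow> nat" where
  "chain_index n D Z = (LEAST a. a < length D \<and> Z \<in> members n (snd (D ! a)))"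

locale explicit_decomposition =
  fixes n :: nat and D :: "(nat \<times> nat list) list"
  assumes valid: "valid_decomposition n D"
begin

lemma chainD:
  assumes "a < length D"
  shows "distinct (snd (D ! a))" "set (snd (D ! a)) \<subseteq> {..<n}"
    "n \<le> 2 * length (snd (D ! a))" "length (snd (D ! a)) \<le> n"
    "n - length (snd (D ! a)) \<le> fst (D ! a)" "fst (D ! a) \<le> length (snd (D ! a))"
proof -
  have "valid_chain n (D ! a)" using valid nth_mem[OF assms] by (simp add: valid_decomposition_def)
  then show *: "distinct (snd (D ! a))" "set (snd (D ! a)) \<subseteq> {..<n}"
    "n \<le> 2 * length (snd (D ! a))"
    "n - length (snd (D ! a)) \<le> fst (D ! a)" "fst (D ! a) \<le> length (snd (D ! a))"
    by (auto simp: valid_chain_def split: prod.splits)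
  show "length (snd (D ! a)) \<le> n"
    using card_mono[OF _ *(2)] distinct_card[OF *(1)] by simp
qed

lemma members_subset: "a < length D \<Longrightarrow> Z \<in> members n (snd (D ! a)) \<Longrightarrow> Z \<subseteq> {..<n}"
  using chainD(2) by (auto simp: members_def dest: in_set_takeD)

lemma members_unique:
  assumes "a < length D" "b < length D" "Z \<in> members n (snd (D ! a))" "Z \<in> members n (snd (D ! b))"
  shows "a = b"
  using distinct_concat_nth[of "\<lambda>p. chain_codes n (snd p)" D a b "encode Z"] valid assms
  by (simp add: valid_decomposition_def Let_def set_chain_codes chainD(1))

lemma ex_members:
  assumes "Z \<subseteq> {..<n}"
  shows "\<exists>a<length D. Z \<in> members n (snd (D ! a))"
proof -
  let ?zs = "concat (map (\<lambda>p. chain_codes n (snd p)) D)"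
  have zs: "set ?zs = (\<Union>a<length D. encode ` members n (snd (D ! a)))"
    using chainD(1) by (auto simp: set_conv_nth[of D] set_chain_codes)
  have inj: "inj_on encode (Pow {..<n})"
    by (rule inj_onI, rule encode_inj) (auto intro: finite_subset[OF _ finite_lessThan])
  have "int (length ?zs) = 2 ^ n" "distinct ?zs"
    using valid by (auto simp: valid_decomposition_def Let_def)
  then have "int (card (set ?zs)) = int (2 ^ n)" using distinct_card[of ?zs] by simp
  then have "card (set ?zs) = card (encode ` Pow {..<n})"
    by (simp only: of_nat_eq_iff card_image[OF inj] card_Pow finite_lessThan card_lessThan)
  moreover have "set ?zs \<subseteq> encode ` Pow {..<n}"
    unfolding zs using members_subset by blast
  ultimately have "set ?zs = encode ` Pow {..<n}" by (intro card_subset_eq) auto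
  then obtain a Y where "a < length D" "Y \<in> members n (snd (D ! a))" "encode Z = encode Y"
    using assms unfolding zs by blast
  moreover from this have "Z = Y"
    using encode_inj[of Z Y] assms members_subset[of a Y] finite_subset[OF _ finite_lessThan] by blast
  ultimately show ?thesis by blast
qed

lemma chain_index_eqI:
  "a < length D \<Longrightarrow> Z \<in> members n (snd (D ! a)) \<Longrightarrow> chain_index n D Z = a"
  unfolding chain_index_def by (rule Least_equality) (auto dest: members_unique)

lemma chain_index:
  assumes "Z \<subseteq> {..<n}"
  shows "chain_index n D Z < length D" "Z \<in> members n (snd (D ! chain_index n D Z))"
  using ex_members[OF assms] chain_index_eqI by auto

lemma chain_labelling:
  "chain_labelling {..<n} (chain_index n D) (\<lambda>Z. n - length (snd (D ! chain_index n D Z)))"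
proof -
  have rank: "\<exists>r. Z = set (take r (snd (D ! chain_index n D Z))) \<and> card Z = r \<and>
      n - length (snd (D ! chain_index n D Z)) \<le> r \<and> r \<le> length (snd (D ! chain_index n D Z))"
    if Z: "Z \<subseteq> {..<n}" for Z
  proof -
    obtain r where r: "Z = set (take r (snd (D ! chain_index n D Z)))"
      "n - length (snd (D ! chain_index n D Z)) \<le> r" "r \<le> length (snd (D ! chain_index n D Z))"
      using chain_index(2)[OF Z] by (auto simp: members_def)
    have "distinct (take r (snd (D ! chain_index n D Z)))"
      using chainD(1)[OF chain_index(1)[OF Z]] by simp
    then have "card Z = r" using r(1,3) distinct_card by (metis length_take min.absorb2)
    then show ?thesis using r by blast
  qed
  show ?thesis
  proof
    show "finite {..<n}" by simp
  next
    fix Z assume Z: "Z \<subseteq> {..<n}"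
    note le = chainD(4)[OF chain_index(1)[OF Z]]
    show "n - length (snd (D ! chain_index n D Z)) \<le> card Z"
      "card Z + (n - length (snd (D ! chain_index n D Z))) \<le> card {..<n}"
      using rank[OF Z] le by auto
    fix r assume r: "n - length (snd (D ! chain_index n D Z)) \<le> r"
      "r + (n - length (snd (D ! chain_index n D Z))) \<le> card {..<n}"
    let ?w = "snd (D ! chain_index n D Z)"
    let ?Y = "set (take r ?w)"
    have "r \<le> length ?w" using r(2) le by simp
    then have "?Y \<in> members n ?w" using r(1) by (auto simp: members_def)
    moreover from this have "chain_index n D ?Y = chain_index n D Z"
      using chain_index_eqI chain_index(1)[OF Z] by blast
    moreover have "card ?Y = r"
      using distinct_card[OF distinct_take[OF chainD(1)[OF chain_index(1)[OF Z]]]] \<open>r \<le> length ?w\<close>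
      by simp
    ultimately show "\<exists>Y\<subseteq>{..<n}. chain_index n D Y = chain_index n D Z \<and> card Y = r"
      using members_subset[OF chain_index(1)[OF Z]] by blast
  next
    fix Y Z assume YZ: "Y \<subseteq> {..<n}" "Z \<subseteq> {..<n}" "chain_index n D Y = chain_index n D Z"
    then show "n - length (snd (D ! chain_index n D Y)) = n - length (snd (D ! chain_index n D Z))"
      by simp
    assume "card Y \<le> card Z"
    then show "Y \<subseteq> Z"
      using rank[OF YZ(1)] rank[OF YZ(2)] YZ(3) set_take_subset_set_take by metis
  qed
qed

end

text \<open>The code 0 of \<open>{}\<close> is left out: then chains sharing \<open>{}\<close>, which also share the full set, can
  share nothing else.\<close>

definition almost_disjoint :: "int list \<Rightarrow> int list \<Rightarrow> bool" where
  "almost_disjoint as bs \<longleftrightarrow>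
     (case filter (\<lambda>z. z \<noteq> 0 \<and> z \<in> set bs) as of _ # _ # _ \<Rightarrow> False | _ \<Rightarrow> True)"

lemma almost_disjointD:
  assumes "almost_disjoint as bs" "y \<in> set as" "y \<in> set bs" "y \<noteq> 0" "z \<in> set as" "z \<in> set bs" "z \<noteq> 0"
  shows "y = z"
proof -
  define F where "F = filter (\<lambda>z. z \<noteq> 0 \<and> z \<in> set bs) as"
  have "y \<in> set F" "z \<in> set F" using assms(2-7) by (simp_all add: F_def)
  moreover have "F = [] \<or> (\<exists>x. F = [x])"
    using assms(1) unfolding almost_disjoint_def F_def[symmetric] by (simp split: list.splits)
  ultimately show ?thesis by auto
qed

definition almost_disjoint_lists :: "int list list \<Rightarrow> int list list \<Rightarrow> bool" where
  "almost_disjoint_lists As Bs \<longleftrightarrow> (\<forall>as\<in>set As. \<forall>bs\<in>set Bs. almost_disjoint as bs)"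

definition orthogonal_lists :: "nat \<Rightarrow> (nat \<times> nat list) list \<Rightarrow> (nat \<times> nat list) list \<Rightarrow> bool" where
  "orthogonal_lists n D E \<longleftrightarrow> almost_disjoint_lists
     (map (\<lambda>p. chain_codes n (snd p)) D) (map (\<lambda>p. chain_codes n (snd p)) E)"

text \<open>If \<open>Y\<close> were nonempty, both sets would have nonzero codes common to the two
  chains, hence equal codes. This is the form \<open>orthogonalI\<close> asks for.\<close>

lemma orthogonal_chain_index:
  assumes D: "valid_decomposition n D" and E: "valid_decomposition n E"
    and orth: "orthogonal_lists n D E"
  shows "orthogonal {..<n} (chain_index n D) (chain_index n E)"
proof -
  interpret D: explicit_decomposition n D by unfold_locales (rule D)
  interpret E: explicit_decomposition n E by unfold_locales (rule E)
  show ?thesis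
  proof (rule orthogonalI[OF D.chain_labelling E.chain_labelling])
    fix Y Z assume YZ: "Y \<subset> Z" "Z \<subseteq> {..<n}" "chain_index n D Y = chain_index n D Z"
      "chain_index n E Y = chain_index n E Z"
    have Y: "Y \<subseteq> {..<n}" using YZ(1,2) by blast
    have fin: "finite Y" "finite Z" using YZ(2) Y finite_subset by blast+
    let ?v = "snd (D ! chain_index n D Z)" and ?w = "snd (E ! chain_index n E Z)"
    note iD = D.chain_index(1)[OF YZ(2)] and iE = E.chain_index(1)[OF YZ(2)]
    have disj: "almost_disjoint (chain_codes n ?v) (chain_codes n ?w)"
      using orth iD iE by (simp add: orthogonal_lists_def almost_disjoint_lists_def)
    have codes: "encode X \<in> set (chain_codes n ?v)" "encode X \<in> set (chain_codes n ?w)"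
      if "X = Y \<or> X = Z" for X
      using that D.chain_index(2)[OF Y] D.chain_index(2)[OF YZ(2)] E.chain_index(2)[OF Y]
        E.chain_index(2)[OF YZ(2)] YZ(3,4) D.chainD(1)[OF iD] E.chainD(1)[OF iE]
      by (auto simp: set_chain_codes)
    show "Y = {}"
    proof (rule ccontr)
      assume "Y \<noteq> {}"
      then have "encode Y \<noteq> 0" "encode Z \<noteq> 0" using encode_eq_0 fin YZ(1) by blast+
      then have "encode Y = encode Z"
        using almost_disjointD[OF disj codes[of Y] _ codes[of Z]] by simp
      then show False using encode_inj[OF fin] YZ(1) by blast
    qed
  qed
qed

section \<open>Checkable certificates for coloured triples\<close>

definition mark_codes :: "(nat \<times> nat list) list \<Rightarrow> int list" where
  "mark_codes D = map (\<lambda>(m, w). prefix_codes 0 w ! m) D"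

text \<open>Joint distinctness of the marks keeps a set from having two colours. Orthogonality is
  symmetric, so \<open>sorted_wrt\<close> checks each pair once.\<close>

definition valid_triple :: "nat \<Rightarrow> (nat \<times> nat list) list list \<Rightarrow> bool" where
  "valid_triple n Ds \<longleftrightarrow> length Ds = 3 \<and> list_all (valid_decomposition n) Ds \<and>
     sorted_wrt (orthogonal_lists n) Ds \<and> distinct (concat (map mark_codes Ds))"

text \<open>A marked set is a mark for one \<open>i\<close> only, which \<open>LEAST\<close>
  returns; other sets get an unspecified colour. Every chain carries a mark, so the strong form
  holds.\<close>

lemma coloured_triple_valid:
  assumes "valid_triple n Ds"
  shows "coloured_triple True {..<n} (\<lambda>i. chain_index n (Ds ! i))
    (\<lambda>i Z. n - length (snd (Ds ! i ! chain_index n (Ds ! i) Z)))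
    (\<lambda>Z. LEAST i. i < 3 \<and> encode Z \<in> set (mark_codes (Ds ! i)))"
proof -
  have len: "length Ds = 3" and distinct: "distinct (concat (map mark_codes Ds))"
    using assms by (simp_all add: valid_triple_def)
  have valid: "valid_decomposition n (Ds ! i)" if "i < 3" for i
    using assms that by (simp add: valid_triple_def list_all_length)
  have loc: "explicit_decomposition n (Ds ! i)" if "i < 3" for i
    using valid[OF that] by unfold_locales
  have orth: "orthogonal {..<n} (chain_index n (Ds ! i)) (chain_index n (Ds ! j))"
    if "i < 3" "j < 3" "i \<noteq> j" for i j
  proof -
    have "orthogonal {..<n} (chain_index n (Ds ! i)) (chain_index n (Ds ! j))" if "i < j" "j < 3" for i j
      using assms orthogonal_chain_index[OF valid valid, of i j] that
      by (simp add: valid_triple_def sorted_wrt_iff_nth_less)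
    then show ?thesis using that orthogonal_sym by (metis nat_neq_iff)
  qed
  have colour: "\<exists>Y\<subseteq>{..<n}. chain_index n (Ds ! i) Y = chain_index n (Ds ! i) Z \<and>
      (LEAST i. i < 3 \<and> encode Y \<in> set (mark_codes (Ds ! i))) = i"
    if i: "i < 3" and Z: "Z \<subseteq> {..<n}" for i Z
  proof -
    let ?a = "chain_index n (Ds ! i) Z"
    obtain m w where mw: "Ds ! i ! ?a = (m, w)" by fastforce
    note locD = explicit_decomposition.chainD[OF loc[OF i]]
    have a: "?a < length (Ds ! i)" using explicit_decomposition.chain_index(1)[OF loc[OF i] Z] .
    have w: "distinct w" "n - length w \<le> m" "m \<le> length w"
      using locD(1,5,6)[OF a] mw by simp_all
    let ?Y = "set (take m w)"
    have Y: "?Y \<in> members n (snd (Ds ! i ! ?a))" using w mw by (auto simp: members_def)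
    have "prefix_codes 0 w ! m = encode ?Y"
      using w by (simp add: prefix_codes_eq del: upt_Suc)
    then have mark: "encode ?Y \<in> set (mark_codes (Ds ! i))"
      using mw nth_mem[OF a] by (force simp: mark_codes_def)
    have "(LEAST i. i < 3 \<and> encode ?Y \<in> set (mark_codes (Ds ! i))) = i"
    proof (rule Least_equality)
      fix j assume "j < 3 \<and> encode ?Y \<in> set (mark_codes (Ds ! j))"
      then have "i = j" using distinct_concat_nth[OF distinct _ _ mark, of j] i len by simp
      then show "i \<le> j" by simp
    qed (use mark i in simp)
    then show ?thesis
      using explicit_decomposition.chain_index_eqI[OF loc[OF i] a Y]
        explicit_decomposition.members_subset[OF loc[OF i] a Y] by blast
  qed
  show ?thesis
    unfolding coloured_triple_def
    using explicit_decomposition.chain_labelling[OF loc] orth colour by simp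
qed

lemma all_coloured_valid:
  assumes "valid_triple n Ds" "0 < n"
  shows "all_coloured True n"
  unfolding all_coloured_def
proof (intro allI impI)
  fix U :: "nat set" assume U: "card U = n"
  then have "finite U" using \<open>0 < n\<close> card_ge_0_finite by blast
  then obtain b where "bij_betw b U {..<n}"
    using ex_bij_betw_finite_nat U by (metis lessThan_atLeast0)
  then show "\<exists>f l c. coloured_triple True U f l c"
    using coloured_triple_image[OF coloured_triple_valid[OF assms(1)]] by blast
qed

text \<open>For prime \<open>n\<close> each set other than \<open>{}\<close> and the whole has
  \<open>n\<close> distinct rotations, so one chain per orbit describes the decomposition of these
  sets.\<close>

definition rotations :: "nat \<Rightarrow> (nat \<times> nat list) list \<Rightarrow> (nat \<times> nat list) list" where
  "rotations n D = concat (map (\<lambda>(m, w). map (\<lambda>s. (m, map (\<lambda>x. (x + s) mod n) w)) [0..<n]) D)"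

text \<open>Appending the missing point to a word of length \<open>n - 1\<close> extends its range
  of prefix lengths at both ends, to \<open>{0..n}\<close>.\<close>

fun complete_first :: "nat \<Rightarrow> (nat \<times> nat list) list \<Rightarrow> (nat \<times> nat list) list" where
  "complete_first n [] = []"
| "complete_first n ((m, w) # D) = (m, w @ filter (\<lambda>x. x \<notin> set w) [0..<n]) # D"

text \<open>The data below were found by a computer search among triples whose chains are permuted by the
  cyclic shift, apart from \<open>{}\<close> and the full set, which extend the first chain.\<close>

lemma all_coloured_5: "all_coloured True 5"
proof (rule all_coloured_valid)
  show "valid_triple 5 (map (complete_first 5 \<circ> rotations 5)
    [[(4, [0,4,2,1]), (2, [0,2,1])],
     [(3, [2,3,1,0]), (3, [0,2,3])],
     [(1, [1,4,3,2]), (2, [0,1,2])]])"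
    by code_simp
qed simp

lemma all_coloured_7: "all_coloured True 7"
proof (rule all_coloured_valid)
  show "valid_triple 7 (map (complete_first 7 \<circ> rotations 7)
    [[(5, [0,6,4,3,1,2]), (5, [0,2,1,3,6]), (2, [0,3,1,5,2]), (4, [0,1,4,2]), (3, [0,2,4,3])],
     [(6, [1,5,2,6,0,3]), (5, [0,1,3,6,5]), (4, [0,2,4,5,1]), (4, [0,1,2,6]), (4, [0,2,3,4])],
     [(1, [6,2,4,3,5,1]), (2, [0,1,4,3,6]), (2, [0,2,3,5,1]), (3, [0,1,2,5]), (3, [0,1,3,2])]])"
    by code_simp
qed simp

section \<open>From labellings to decompositions\<close>

definition fibres :: "nat set \<Rightarrow> (nat set \<Rightarrow> nat) \<Rightarrow> nat set set set" where
  "fibres U f = (\<lambda>Z. {Y. Y \<subseteq> U \<and> f Y = f Z}) ` Pow U"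

lemma symmetric_chain_decomposition_fibres:
  assumes "chain_labelling {1..n} f l"
  shows "symmetric_chain_decomposition n (fibres {1..n} f)"
proof -
  interpret chain_labelling "{1..n}" f l by fact
  have "partition_on (hypercube n) (fibres {1..n} f)"
    by (rule partition_onI) (auto simp: hypercube_def fibres_def disjnt_def)
  moreover have "symmetric_chain n C" if C_in: "C \<in> fibres {1..n} f" for C
  proof -
    obtain Z where Z: "Z \<subseteq> {1..n}" and C: "C = {Y. Y \<subseteq> {1..n} \<and> f Y = f Z}"
      using C_in unfolding fibres_def by blast
    have "subset.chain (hypercube n) C"
      using same_label_subset by (auto simp: subset_chain_def C hypercube_def)
    moreover have "bij_betw card C {l Z..n - l Z}"
    proof (rule bij_betw_imageI)
      show "inj_on card C"
        by (rule inj_onI) (simp add: C eq_if_card_eq)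
      show "card ` C = {l Z..n - l Z}"
      proof (intro equalityI subsetI)
        fix r assume "r \<in> card ` C"
        then obtain Y where "Y \<subseteq> {1..n}" "f Y = f Z" "r = card Y" by (auto simp: C)
        then show "r \<in> {l Z..n - l Z}"
          using l_le[of Y] l_le_codim[of Y] l_cong[of Y Z] Z by auto
      next
        fix r assume "r \<in> {l Z..n - l Z}"
        then obtain Y where "Y \<subseteq> {1..n}" "f Y = f Z" "card Y = r"
          using ex_rank[OF Z, of r] l_le_codim[OF Z] le_diff_conv2[of "l Z" n r] twice_l_le[OF Z]
          by auto
        then show "r \<in> card ` C" by (auto simp: C)
      qed
    qed
    ultimately show ?thesis
      unfolding symmetric_chain_def using twice_l_le[OF Z] by auto
  qed
  ultimately show ?thesis by (simp add: symmetric_chain_decomposition_def)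
qed

text \<open>Sets common to two chains are comparable, so two distinct ones must be \<open>{}\<close>
  and \<open>{1..n}\<close>.\<close>

lemma almost_orthogonal_fibres:
  assumes f: "chain_labelling {1..n} f l" and orth: "orthogonal {1..n} f g" and "0 < n"
  shows "almost_orthogonal n (fibres {1..n} f) (fibres {1..n} g)"
  unfolding almost_orthogonal_def
proof (intro ballI)
  interpret chain_labelling "{1..n}" f l by (rule f)
  fix A B assume AB: "A \<in> fibres {1..n} f" "B \<in> fibres {1..n} g"
  have same: "f Y = f Z" "g Y = g Z" "Y \<subseteq> {1..n}" "Z \<subseteq> {1..n}" if "Y \<in> A \<inter> B" "Z \<in> A \<inter> B" for Y Z
    using that AB by (auto simp: fibres_def)
  have extremes: "Y = {} \<and> Z = {1..n}" if "Y \<in> A \<inter> B" "Z \<in> A \<inter> B" "Y \<subset> Z" for Y Z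
    using orthogonalD[OF orth that(3) same(4,1,2)[OF that(1,2)]] .
  show "if {{}, {1..n}} \<subseteq> A \<and> {{}, {1..n}} \<subseteq> B then card (A \<inter> B) = 2 else card (A \<inter> B) \<le> 1"
  proof (cases "{{}, {1..n}} \<subseteq> A \<and> {{}, {1..n}} \<subseteq> B")
    case True
    then have "A \<inter> B = {{}, {1..n}}" using extremes[of "{}"] by blast
    moreover have "{1..n} \<noteq> {}" using \<open>0 < n\<close> by simp
    ultimately show ?thesis using True by simp
  next
    case False
    have "Y = Z" if YZ: "Y \<in> A \<inter> B" "Z \<in> A \<inter> B" for Y Z
    proof (rule ccontr)
      assume "Y \<noteq> Z"
      then have "Y \<subset> Z \<or> Z \<subset> Y" using same_label_subset[OF same(3,4,1)[OF YZ]] by blast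
      then have "{} \<in> A \<inter> B \<and> {1..n} \<in> A \<inter> B" using extremes YZ by metis
      then show False using False by blast
    qed
    moreover have "finite (A \<inter> B)"
    proof (rule finite_subset)
      show "A \<inter> B \<subseteq> Pow {1..n}" using same(3) by blast
    qed simp
    ultimately have "card (A \<inter> B) \<le> 1" by (simp add: card_le_Suc0_iff_eq)
    then show ?thesis using False by simp
  qed
qed

text \<open>This makes the final family have three members. If the decompositions agreed, the
  singleton on the chain of \<open>{}\<close> would share both labels with \<open>{}\<close> and so
  equal \<open>{1..n}\<close>.\<close>

lemma fibres_neq:
  assumes f: "chain_labelling {1..n} f l" and orth: "orthogonal {1..n} f g" and "1 < n"
  shows "fibres {1..n} f \<noteq> fibres {1..n} g"
proof
  interpret chain_labelling "{1..n}" f l by (rule f)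
  assume "fibres {1..n} f = fibres {1..n} g"
  moreover have "{Y. Y \<subseteq> {1..n} \<and> f Y = f {}} \<in> fibres {1..n} f"
    by (auto simp: fibres_def)
  ultimately obtain Z where Z: "{Y. Y \<subseteq> {1..n} \<and> f Y = f {}} = {Y. Y \<subseteq> {1..n} \<and> g Y = g Z}"
    unfolding fibres_def by (metis (no_types, lifting) imageE)
  obtain Y where Y: "Y \<subseteq> {1..n}" "f Y = f {}" "card Y = 1"
    using ex_rank[of "{}" 1] l_empty \<open>1 < n\<close> by auto
  then have "g {} = g Z" "g Y = g Z" using Z by blast+
  moreover have "{} \<subset> Y" using Y(3) by auto
  ultimately have "Y = {1..n}" using orthogonalD[OF orth _ Y(1), of "{}"] Y(2) by simp
  then show False using Y(3) \<open>1 < n\<close> by simp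
qed

theorem theorem3p1:
  shows "\<exists>N0::nat. \<forall>n\<ge>N0. \<exists>S. card S = 3 \<and> almost_orthogonal_family n S"
proof (intro exI[of _ 24] allI impI)
  fix n :: nat assume n: "24 \<le> n"
  have "all_coloured False n"
    using all_coloured_ge_24[OF all_coloured_5 all_coloured_7 n] .
  moreover have "card {1..n} = n" by simp
  ultimately obtain f l c where T: "coloured_triple False {1..n} f l c"
    unfolding all_coloured_def by blast
  let ?F = "\<lambda>i. fibres {1..n} (f i)"
  note lab = coloured_tripleD(1)[OF T] and orth = coloured_tripleD(3)[OF T]
  have neq: "?F i \<noteq> ?F j" if "i < 3" "j < 3" "i \<noteq> j" for i j
    using fibres_neq[OF lab[OF that(1)] orth[OF that(1,3,2)]] n by simp
  have "inj_on ?F {..<3}"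
    using neq by (intro inj_onI) (metis lessThan_iff)
  then have "card (?F ` {..<3}) = 3" by (simp add: card_image)
  moreover have "symmetric_chain_decomposition n (?F i)" if "i < 3" for i
    using symmetric_chain_decomposition_fibres[OF lab[OF that]] .
  moreover have "almost_orthogonal n (?F i) (?F j)" if "i < 3" "j < 3" "i \<noteq> j" for i j
    using almost_orthogonal_fibres[OF lab[OF that(1)] orth[OF that(1,3,2)]] n by simp
  ultimately show "\<exists>S. card S = 3 \<and> almost_orthogonal_family n S"
    by (intro exI[of _ "?F ` {..<3}"])
      (auto simp: almost_orthogonal_family_def pairwise_def)
qed

end
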